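(* Let $s\geq 1$, $k\geq 1$ and $p\geq 1$ be integers, and let $n_1,\dots,n_p$ be positive integers with $n_1\geq sk+1$ and $n_i\geq sk$ for $i=2,\dots,p$. Let \[ \mathcal{A}_{(1,1)}^{s,k}(n_1,\dots,n_p)=\{A\in[n_1,\dots,n_p]_k^s:\ (1,1)\in A\}. \] Then, with $N=\sum_{i=1}^p n_i$, \[ \left|\mathcal{A}_{(1,1)}^{s,k}(n_1,\dots,n_p)\right| = \binom{N-sk-1}{k-1}. \]
   Context: For positive integers $n_1,\dots,n_p$, let $[n]=\{1,\dots,n\}$ and $[n_1,\dots,n_p]=([n_1]\times\{1\})\cup\cdots\cup([n_p]\times\{p\})$; the elements with second coordinate $i$ are regarded as arranged in cyclic order $1,2,\dots,n_i$ around the $i$-th circle (so $n_i$ is followed by $1$). A subset of $[n_1,\dots,n_p]$ is $s$-separated if no two of its elements lie in the same circle with fewer than $s$ elements of that circle between them; i.e. for any two distinct elements $(a,i),(b,i)$ of the set in the same circle of size $n_i$, both $|a-b|-1\geq s$ and $n_i-|a-b|-1\geq s$. Elements in different circles impose no restriction. $[n_1,\dots,n_p]_k^s$ denotes the set of $s$-separated $k$-element subsets of $[n_1,\dots,n_p]$. *)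

theory Defs
  imports Complex_Main
begin

text \<open>
  The sequence \<open>n\<^sub>1, \<dots>, n\<^sub>p\<close> is a function \<open>n\<close> on the
  naturals, of which only the values at \<open>1, \<dots>, p\<close> are used.
\<close>

definition circles :: "nat \<Rightarrow> (nat \<Rightarrow> nat) \<Rightarrow> (nat \<times> nat) set" where
  "circles p n = (\<Union>i\<in>{1..p}. {1..n i} \<times> {i})"

text \<open>Distances are taken in the integers, so that subtraction does not truncate.\<close>

definition separated :: "nat \<Rightarrow> (nat \<Rightarrow> nat) \<Rightarrow> (nat \<times> nat) set \<Rightarrow> bool" where
  "separated s n A \<longleftrightarrow>
    (\<forall>a b i. (a, i) \<in> A \<and> (b, i) \<in> A \<and> a \<noteq> b \<longrightarrow>
      \<bar>int a - int b\<bar> - 1 \<ge> int s \<and> int (n i) - \<bar>int a - int b\<bar> - 1 \<ge> int s)"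

definition separated_subsets :: "nat \<Rightarrow> nat \<Rightarrow> nat \<Rightarrow> (nat \<Rightarrow> nat) \<Rightarrow> (nat \<times> nat) set set" where
  "separated_subsets s k p n = {A. A \<subseteq> circles p n \<and> card A = k \<and> separated s n A}"

definition separated_star ::
    "nat \<times> nat \<Rightarrow> nat \<Rightarrow> nat \<Rightarrow> nat \<Rightarrow> (nat \<Rightarrow> nat) \<Rightarrow> (nat \<times> nat) set set" where
  "separated_star x s k p n = {A \<in> separated_subsets s k p n. x \<in> A}"

end

theory Submission
  imports Defs
begin

text \<open>
  Let \<open>b\<^sub>m(j)\<close> be the number of separated \<open>j\<close>-subsets of a single circle of size \<open>m\<close>. Such a set
  meets \<open>{1..s}\<close> at most once; cutting the circle there reduces the count to separated subsets of an
  interval and gives \<open>b\<^sub>m(j) = (m - s j choose j) + s (m - s j - 1 choose (j - 1))\<close>.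
  Adding a circle of size \<open>m\<close> convolves the count of the star with \<open>b\<^sub>m\<close>. The circle through the
  fixed point contributes \<open>m - s k - 1 choose (k - 1)\<close>, and the convolution is evaluated by the
  Rothe--Hagen identity, which preserves this form.
\<close>

section \<open>The Rothe--Hagen identity\<close>

text \<open>Continues the circle count \<open>b\<^sub>m(j)\<close> to every integer \<open>x\<close>
  in place of \<open>m\<close>; away from \<open>x = s j\<close> the value is
  \<open>x / (x - s j)\<close> times \<open>(x - s j) gchoose j\<close>. Integer arguments allow the
  shift \<open>x - s\<close> and the starting value at 0.\<close>

fun rothe :: "int \<Rightarrow> nat \<Rightarrow> int \<Rightarrow> real" where
  "rothe s 0 x = 1"
| "rothe s (Suc j) x = (of_int (x - int (Suc j) * s) gchoose Suc j)
     + of_int s * (of_int (x - int (Suc j) * s - 1) gchoose j)"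

text \<open>Pascal's rule in both summands; the lower-order pieces reassemble because
  \<open>x - (j + 1) s = (x - s) - j s\<close>.\<close>

lemma rothe_Suc_diff: "rothe s (Suc j) (x + 1) = rothe s (Suc j) x + rothe s j (x - s)"
proof (cases j)
  case 0
  then show ?thesis by simp
next
  case (Suc i)
  have P: "(a + 1) gchoose Suc m = (a gchoose m) + (a gchoose Suc m)" for a :: real and m
    by (rule gbinomial_Suc_Suc)
  define w :: real where "w = of_int (x - int (Suc j) * s)"
  have "rothe s (Suc j) (x + 1) = ((w + 1) gchoose Suc j) + of_int s * (((w - 1) + 1) gchoose j)"
    by (simp add: w_def algebra_simps)
  also have "\<dots> = (w gchoose Suc j) + of_int s * ((w - 1) gchoose j)
      + ((w gchoose j) + of_int s * ((w - 1) gchoose i))"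
    unfolding Suc P by (simp add: algebra_simps)
  also have "\<dots> = rothe s (Suc j) x + rothe s j (x - s)"
    by (simp add: w_def Suc algebra_simps)
  finally show ?thesis .
qed

text \<open>Absorption makes the two summands cancel, so at 0 only the term \<open>j = 0\<close> of
  the Rothe--Hagen sum survives.\<close>

lemma rothe_Suc_at_0: "rothe s (Suc j) 0 = 0"
proof -
  define w :: real where "w = of_int (- (int (Suc j) * s))"
  have "of_nat (Suc j) * (w gchoose Suc j) = w * ((w - 1) gchoose j)"
    by (rule gbinomial_absorption)
  also have "\<dots> = - of_nat (Suc j) * (of_int s * ((w - 1) gchoose j))"
    by (simp add: w_def algebra_simps)
  finally have "of_nat (Suc j) * ((w gchoose Suc j) + of_int s * ((w - 1) gchoose j)) = 0"
    by (simp only: distrib_left)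
  then have "(w gchoose Suc j) + of_int s * ((w - 1) gchoose j) = 0"
    using of_nat_neq_0 mult_eq_0_iff by blast
  then show ?thesis by (simp add: w_def)
qed

text \<open>Both sides satisfy the same first-order difference equation in \<open>x\<close> and agree at \<open>x = 0\<close>.\<close>

lemma rothe_hagen:
  fixes y :: real
  shows "(\<Sum>j\<le>k. rothe s j x * ((y - of_nat (k - j) * of_int s) gchoose (k - j)))
    = (of_int x + y - of_nat k * of_int s) gchoose k"
proof (induction k arbitrary: x)
  case 0
  show ?case by simp
next
  case (Suc k)
  define B where "B j = (y - of_nat j * of_int s) gchoose j" for j
  define S where "S x = (\<Sum>j\<le>Suc k. rothe s j x * B (Suc k - j))" for x
  define R where "R x = (of_int x + y - of_nat (Suc k) * of_int s) gchoose Suc k" for x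
  \<comment> \<open>The term \<open>j = 0\<close> is constant in \<open>x\<close>, so the difference
    in \<open>x\<close> acts only on the remaining terms and leaves a sum of order \<open>k\<close>
    at \<open>x - s\<close>, which the induction hypothesis evaluates.\<close>
  have S: "S x = B (Suc k) + (\<Sum>j\<le>k. rothe s (Suc j) x * B (k - j))" for x
    unfolding S_def by (subst sum.atMost_Suc_shift) simp
  have "S (x + 1) = S x + (\<Sum>j\<le>k. rothe s j (x - s) * B (k - j))" for x
    unfolding S rothe_Suc_diff by (simp only: distrib_right sum.distrib add.assoc)
  then have Sd: "S (x + 1) = S x + ((of_int (x - s) + y - of_nat k * of_int s) gchoose k)" for x
    using Suc.IH by (simp add: B_def)
  have Rd: "R (x + 1) = R x + ((of_int (x - s) + y - of_nat k * of_int s) gchoose k)" for x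
  proof -
    define w where "w = of_int x + y - of_nat (Suc k) * of_int s"
    have "R (x + 1) = (w + 1) gchoose Suc k" by (simp add: R_def w_def algebra_simps)
    also have "\<dots> = (w gchoose k) + (w gchoose Suc k)" by (rule gbinomial_Suc_Suc)
    finally show ?thesis by (simp add: R_def w_def algebra_simps)
  qed
  have "S x = R x"
  \<comment> \<open>Both directions are needed: the induction hypothesis is applied at
    \<open>x - s\<close>, which may be negative.\<close>
  proof (induction x rule: int_induct [where k = 0])
    case base
    show ?case unfolding S rothe_Suc_at_0 by (simp add: B_def R_def)
  next
    case (step1 i)
    then show ?case by (simp only: Sd Rd)
  next
    case (step2 i)
    then show ?case using Sd [of "i - 1"] Rd [of "i - 1"] by simp
  qed
  then show ?case by (simp only: S_def R_def B_def)
qed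

section \<open>Separated subsets of an interval\<close>

text \<open>The offset \<open>m\<close> is kept because the intervals cut from a circle begin after
  \<open>s\<close> or after \<open>x + s\<close>.\<close>

definition line_sets :: "nat \<Rightarrow> nat \<Rightarrow> nat \<Rightarrow> nat \<Rightarrow> nat set set" where
  "line_sets s m l j = {A. A \<subseteq> {m<..m + l} \<and> card A = j \<and> (\<forall>a\<in>A. \<forall>b\<in>A. a < b \<longrightarrow> a + s < b)}"

lemma finite_line_sets: "finite (line_sets s m l j)"
  by (rule finite_subset [of _ "Pow {m<..m + l}"]) (auto simp: line_sets_def)

lemma line_sets_0: "line_sets s m l 0 = {{}}"
proof -
  have "A = {}" if "A \<subseteq> {m<..m + l}" "card A = 0" for A
    using that finite_subset [OF that(1)] by simp
  then show ?thesis by (auto simp: line_sets_def)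
qed

text \<open>Case split on the largest point of the interval: using it excludes the \<open>s\<close>
  points below. If \<open>l < s\<close>, the truncated length \<open>l - s = 0\<close> is the
  correct one.\<close>

lemma line_sets_Suc:
  "line_sets s m (Suc l) (Suc j) =
    line_sets s m l (Suc j) \<union> insert (Suc (m + l)) ` line_sets s m (l - s) j"
proof (intro set_eqI iffI)
  fix A assume "A \<in> line_sets s m (Suc l) (Suc j)"
  then have A: "A \<subseteq> {m<..m + Suc l}" "card A = Suc j"
    and sep: "\<And>a b. a \<in> A \<Longrightarrow> b \<in> A \<Longrightarrow> a < b \<Longrightarrow> a + s < b"
    by (auto simp: line_sets_def)
  have fin: "finite A" using A(1) finite_subset by blast
  show "A \<in> line_sets s m l (Suc j) \<union> insert (Suc (m + l)) ` line_sets s m (l - s) j"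
  proof (cases "Suc (m + l) \<in> A")
    case True
    define B where "B = A - {Suc (m + l)}"
    have "B \<subseteq> {m<..m + (l - s)}"
    proof
      fix b assume "b \<in> B"
      then have "b \<in> A" "b < Suc (m + l)" "m < b" using A(1) by (auto simp: B_def)
      then show "b \<in> {m<..m + (l - s)}" using sep [of b "Suc (m + l)"] True by auto
    qed
    moreover have "card B = j" using A(2) fin True by (simp add: B_def)
    ultimately have "B \<in> line_sets s m (l - s) j"
      using sep by (auto simp: line_sets_def B_def)
    moreover have "A = insert (Suc (m + l)) B" using True by (auto simp: B_def)
    ultimately show ?thesis by blast
  next
    case False
    then have "A \<subseteq> {m<..m + l}" using A(1) by (force simp: le_Suc_eq)
    then show ?thesis using A sep by (auto simp: line_sets_def)
  qed
next
  fix A assume "A \<in> line_sets s m l (Suc j) \<union> insert (Suc (m + l)) ` line_sets s m (l - s) j"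
  then show "A \<in> line_sets s m (Suc l) (Suc j)"
  proof
    assume "A \<in> line_sets s m l (Suc j)"
    then show ?thesis by (auto simp: line_sets_def)
  next
    assume "A \<in> insert (Suc (m + l)) ` line_sets s m (l - s) j"
    then obtain B where B: "B \<in> line_sets s m (l - s) j" and A: "A = insert (Suc (m + l)) B"
      by blast
    have bnd: "m < b \<and> b \<le> m + (l - s)" if "b \<in> B" for b
      using that B by (auto simp: line_sets_def)
    have sep: "a + s < b" if "a \<in> B" "b \<in> B" "a < b" for a b
      using that B by (auto simp: line_sets_def)
    have fin: "finite B" and card: "card B = j"
      using B finite_subset by (auto simp: line_sets_def)
    have "Suc (m + l) \<notin> B" using bnd by fastforce
    then have "card A = Suc j" using fin card A by simp
    moreover have "A \<subseteq> {m<..m + Suc l}" using bnd A by fastforce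
    moreover have "a + s < b" if "a \<in> A" "b \<in> A" "a < b" for a b
      using that bnd [of a] bnd [of b] sep [of a b] by (auto simp: A)
    ultimately show ?thesis unfolding line_sets_def by blast
  qed
qed

text \<open>Truncated subtraction is harmless: if \<open>l + s < s * j\<close> then \<open>j > 0\<close> and both sides vanish.\<close>

lemma card_line_sets: "card (line_sets s m l j) = (l + s - s * j) choose j"
proof (induction l arbitrary: j rule: less_induct)
  case (less l)
  show ?case
  proof (cases j)
    case 0
    then show ?thesis by (simp add: line_sets_0)
  next
    case j: (Suc i)
    show ?thesis
    proof (cases l)
      case 0
      then have "line_sets s m l j = {}" using j by (auto simp: line_sets_def)
      then show ?thesis using 0 j by simp
    next
      case l: (Suc t)
      have notin: "Suc (m + t) \<notin> B" if "B \<in> line_sets s m (t - s) i" for B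
        using that by (auto simp: line_sets_def)
      have "inj_on (insert (Suc (m + t))) (line_sets s m (t - s) i)"
        by (rule inj_onI) (metis notin insert_ident)
      moreover have "line_sets s m t (Suc i) \<inter> insert (Suc (m + t)) ` line_sets s m (t - s) i = {}"
        by (auto simp: line_sets_def)
      ultimately have "card (line_sets s m l j) =
          card (line_sets s m t (Suc i)) + card (line_sets s m (t - s) i)"
        unfolding l j line_sets_Suc
        by (simp add: card_Un_disjoint finite_line_sets card_image)
      also have "\<dots> = ((t + s - s * Suc i) choose Suc i) + ((t - s + s - s * i) choose i)"
        using less.IH [of t "Suc i"] less.IH [of "t - s" i] l by simp
      also have "\<dots> = (l + s - s * j) choose j"
      \<comment> \<open>The term \<open>t - s + s\<close> equals \<open>t\<close> only for
        \<open>s \<le> t\<close>. For \<open>i = 0\<close> its binomial is 1 anyway; for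
        \<open>i > 0\<close> either \<open>s \<le> s * i \<le> t\<close>, or all three upper indices
        are 0.\<close>
      proof (cases "i = 0")
        case True
        then show ?thesis using l j by simp
      next
        case False
        then have si: "s \<le> s * i" by simp
        show ?thesis
        proof (cases "s * i \<le> t")
          case True
          moreover have "t - s + s = t" using True si by linarith
          ultimately show ?thesis using l j by (simp add: Suc_diff_le)
        next
          case F: False
          then have "t + s - s * Suc i = 0" "t - s + s - s * i = 0" "l + s - s * j = 0"
            unfolding l j using si F mult_Suc_right [of s i] by linarith+
          then show ?thesis using False j by (simp del: mult_Suc_right)
        qed
      qed
      finally show ?thesis .
    qed
  qed
qed

section \<open>Separated subsets of a circle\<close>

definition circle_sets :: "nat \<Rightarrow> nat \<Rightarrow> nat \<Rightarrow> nat set set" where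
  "circle_sets s m j = {A. A \<subseteq> {1..m} \<and> card A = j \<and>
    (\<forall>a\<in>A. \<forall>b\<in>A. a < b \<longrightarrow> a + s < b \<and> b + s < a + m)}"

lemma finite_circle_sets: "finite (circle_sets s m j)"
  by (rule finite_subset [of _ "Pow {1..m}"]) (auto simp: circle_sets_def)

lemma circle_sets_finite: "A \<in> circle_sets s m j \<Longrightarrow> finite A"
  by (auto simp: circle_sets_def intro: finite_subset)

lemma circle_sets_0: "circle_sets s m 0 = {{}}"
proof -
  have "A = {}" if "A \<subseteq> {1..m}" "card A = 0" for A
    using that finite_subset [OF that(1)] by simp
  then show ?thesis by (auto simp: circle_sets_def)
qed

text \<open>If \<open>x \<le> s\<close>, the points compatible with \<open>x\<close> form an interval that does not wrap around the
  circle, on which cyclic separation is the same as linear separation.\<close>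

lemma circle_sets_containing:
  assumes x: "1 \<le> x" "x \<le> s" "x \<le> m"
  shows "{A \<in> circle_sets s m (Suc j). x \<in> A} = insert x ` line_sets s (x + s) (m - 2 * s - 1) j"
proof (intro set_eqI iffI)
  fix A assume "A \<in> {A \<in> circle_sets s m (Suc j). x \<in> A}"
  then have A: "A \<subseteq> {1..m}" "card A = Suc j" "x \<in> A"
    and sep: "\<And>a b. a \<in> A \<Longrightarrow> b \<in> A \<Longrightarrow> a < b \<Longrightarrow> a + s < b \<and> b + s < a + m"
    by (auto simp: circle_sets_def)
  have fin: "finite A" using A(1) finite_subset by blast
  define B where "B = A - {x}"
  have "B \<subseteq> {x + s<..x + s + (m - 2 * s - 1)}"
  proof
    fix b assume "b \<in> B"
    then have "b \<in> A" "b \<noteq> x" by (auto simp: B_def)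
    \<comment> \<open>A point \<open>b < x\<close> would need \<open>b + s < x \<le> s\<close>,
      which is impossible.\<close>
    then show "b \<in> {x + s<..x + s + (m - 2 * s - 1)}" using sep [of b x] sep [of x b] A(3) x by (cases "b < x") auto
  qed
  moreover have "card B = j" using A fin by (simp add: B_def)
  ultimately have "B \<in> line_sets s (x + s) (m - 2 * s - 1) j"
    using sep by (auto simp: line_sets_def B_def)
  moreover have "A = insert x B" using A(3) by (auto simp: B_def)
  ultimately show "A \<in> insert x ` line_sets s (x + s) (m - 2 * s - 1) j" by blast
next
  fix A assume "A \<in> insert x ` line_sets s (x + s) (m - 2 * s - 1) j"
  then obtain B where B: "B \<in> line_sets s (x + s) (m - 2 * s - 1) j" and A: "A = insert x B"
    by blast
  have bnd: "x + s < b \<and> b + s < x + m" if "b \<in> B" for b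
  proof -
    have "x + s < b \<and> b \<le> x + s + (m - 2 * s - 1)" using that B by (auto simp: line_sets_def)
    then show ?thesis by linarith
  qed
  have sep: "a + s < b" if "a \<in> B" "b \<in> B" "a < b" for a b
    using that B by (auto simp: line_sets_def)
  have fin: "finite B" and card: "card B = j" using B finite_subset by (auto simp: line_sets_def)
  have "x \<notin> B" using bnd by fastforce
  then have "card A = Suc j" using fin card A by simp
  \<comment> \<open>From \<open>b + s < x + m\<close> and \<open>x \<le> s\<close> follows
    \<open>b < m\<close>: the interval does not wrap around.\<close>
  moreover have "A \<subseteq> {1..m}" using bnd x A by fastforce
  moreover have "a + s < b \<and> b + s < a + m" if "a \<in> A" "b \<in> A" "a < b" for a b
    using that bnd [of a] bnd [of b] sep [of a b] by (auto simp: A)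
  ultimately show "A \<in> {A \<in> circle_sets s m (Suc j). x \<in> A}"
    unfolding circle_sets_def A by blast
qed

text \<open>The count does not depend on \<open>x\<close>, which produces the factor
  \<open>s\<close> in the formula for a whole circle.\<close>

lemma card_circle_sets_containing:
  assumes "1 \<le> x" "x \<le> s" "x \<le> m"
  shows "card {A \<in> circle_sets s m (Suc j). x \<in> A} = (m - s * Suc j - 1) choose j"
proof -
  have notin: "x \<notin> B" if "B \<in> line_sets s (x + s) l j" for B l
    using that by (auto simp: line_sets_def)
  have "inj_on (insert x) (line_sets s (x + s) (m - 2 * s - 1) j)"
    by (rule inj_onI) (metis notin insert_ident)
  then have *: "card {A \<in> circle_sets s m (Suc j). x \<in> A} = (m - 2 * s - 1 + s - s * j) choose j"
    unfolding circle_sets_containing [OF assms] by (simp add: card_image card_line_sets)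
  show ?thesis
  \<comment> \<open>Guards against truncation: the upper indices agree for
    \<open>m \<ge> 2 s + 1\<close>; otherwise \<open>j = 0\<close> makes both binomials 1, or
    \<open>j > 0\<close> with both upper indices 0.\<close>
  proof (cases "j = 0 \<or> 2 * s + 1 \<le> m")
    case True
    then show ?thesis unfolding * by (auto simp: algebra_simps)
  next
    case False
    then have "s \<le> s * j" "m \<le> 2 * s" by simp_all
    then have "m - 2 * s - 1 + s - s * j = 0" "m - s * Suc j - 1 = 0"
      using mult_Suc_right [of s j] by linarith+
    then show ?thesis unfolding * by simp
  qed
qed

text \<open>With \<open>{1..s}\<close> empty, the wrap-around condition is automatic:
  \<open>s < a\<close> and \<open>b \<le> m\<close> give \<open>b + s < a + m\<close>.\<close>

lemma circle_sets_avoiding: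
  assumes "s \<le> m"
  shows "{A \<in> circle_sets s m j. A \<inter> {1..s} = {}} = line_sets s s (m - s) j"
proof (intro set_eqI iffI)
  fix A assume "A \<in> {A \<in> circle_sets s m j. A \<inter> {1..s} = {}}"
  then show "A \<in> line_sets s s (m - s) j"
    using assms by (fastforce simp: circle_sets_def line_sets_def)
next
  fix A assume "A \<in> line_sets s s (m - s) j"
  then have A: "A \<subseteq> {s<..m}" "card A = j" "\<forall>a\<in>A. \<forall>b\<in>A. a < b \<longrightarrow> a + s < b"
    using assms by (auto simp: line_sets_def)
  have "b + s < a + m" if "a \<in> A" "b \<in> A" for a b
  proof -
    have "s < a" "b \<le> m" using that A(1) by auto
    then show ?thesis by simp
  qed
  then show "A \<in> {A \<in> circle_sets s m j. A \<inter> {1..s} = {}}"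
    using A by (fastforce simp: circle_sets_def)
qed

lemma card_circle_sets_Suc:
  assumes "s \<le> m"
  shows "card (circle_sets s m (Suc j)) =
    ((m - s * Suc j) choose Suc j) + s * ((m - s * Suc j - 1) choose j)"
proof -
  let ?C = "circle_sets s m (Suc j)"
  let ?D = "{A \<in> ?C. A \<inter> {1..s} = {}}" and ?E = "\<lambda>x. {A \<in> ?C. x \<in> A}"
  \<comment> \<open>Two points of \<open>{1..s}\<close> are too close to lie in one separated set,
    so the sets meeting \<open>{1..s}\<close> split by their unique point there.\<close>
  have disj: "?E x \<inter> ?E y = {}" if "x \<in> {1..s}" "y \<in> {1..s}" "x \<noteq> y" for x y
  proof -
    have False if "A \<in> ?C" "x \<in> A" "y \<in> A" for A
    proof -
      have "x < y \<longrightarrow> x + s < y" "y < x \<longrightarrow> y + s < x"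
        using that by (auto simp: circle_sets_def)
      then show False using \<open>x \<in> {1..s}\<close> \<open>y \<in> {1..s}\<close> \<open>x \<noteq> y\<close> by auto
    qed
    then show ?thesis by blast
  qed
  have "?C = ?D \<union> (\<Union>x\<in>{1..s}. ?E x)" by blast
  then have "card ?C = card (?D \<union> (\<Union>x\<in>{1..s}. ?E x))" by simp
  also have "\<dots> = card ?D + card (\<Union>x\<in>{1..s}. ?E x)"
    by (intro card_Un_disjoint) (auto simp: finite_circle_sets)
  also have "card (\<Union>x\<in>{1..s}. ?E x) = (\<Sum>x\<in>{1..s}. card (?E x))"
    by (intro card_UN_disjoint) (use disj in \<open>auto simp: finite_circle_sets\<close>)
  also have "\<dots> = (\<Sum>x\<in>{1..s}. (m - s * Suc j - 1) choose j)"
    using assms by (intro sum.cong refl card_circle_sets_containing) auto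
  also have "card ?D = (m - s * Suc j) choose Suc j"
    using assms by (simp only: circle_sets_avoiding card_line_sets le_add_diff_inverse2)
  finally show ?thesis by simp
qed

text \<open>For \<open>j > 0\<close> the hypotheses give \<open>s * j + 1 \<le> m\<close>, so no
  subtraction truncates and \<open>gchoose\<close> has natural upper indices, where it agrees with
  \<open>choose\<close>.\<close>

lemma real_card_circle_sets:
  assumes "s * Suc j \<le> m" "1 \<le> s"
  shows "real (card (circle_sets s m j)) = rothe (int s) j (int m)"
proof (cases j)
  case 0
  then show ?thesis by (simp add: circle_sets_0)
next
  case (Suc i)
  have le: "s * Suc i + 1 \<le> m" "s \<le> m" using assms Suc by auto
  then have "(of_int (int m - int (Suc i) * int s) :: real) = of_nat (m - s * Suc i)"
    "(of_int (int m - int (Suc i) * int s - 1) :: real) = of_nat (m - s * Suc i - 1)"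
    by (simp_all add: of_nat_diff algebra_simps)
  then show ?thesis
    unfolding Suc rothe.simps card_circle_sets_Suc [OF le(2)]
    by (simp only: of_nat_add of_nat_mult binomial_gbinomial of_int_of_nat_eq)
qed

section \<open>Several circles\<close>

lemma finite_circles: "finite (circles p n)"
  by (auto simp: circles_def)

lemma finite_separated_star: "finite (separated_star x s k p n)"
  by (rule finite_subset [of _ "Pow (circles p n)"])
    (auto simp: separated_star_def separated_subsets_def finite_circles)

text \<open>Removes the convolution term in which all points lie on the new circle.\<close>

lemma separated_star_0: "separated_star x s 0 p n = {}"
proof -
  have "A = {}" if "A \<subseteq> circles p n" "card A = 0" for A
    using that finite_subset [OF that(1) finite_circles] by simp
  then show ?thesis by (auto simp: separated_star_def separated_subsets_def)
qed

text \<open>By symmetry only \<open>a < b\<close> matters; moving the subtractions across gives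
  natural-number inequalities in the shape of \<open>circle_sets\<close>.\<close>

lemma separated_iff:
  "separated s n A \<longleftrightarrow>
    (\<forall>a b i. (a, i) \<in> A \<and> (b, i) \<in> A \<and> a < b \<longrightarrow> a + s < b \<and> b + s < a + n i)"
  (is "_ \<longleftrightarrow> ?R")
proof
  assume L: "separated s n A"
  show ?R
  proof (intro allI impI)
    fix a b i assume H: "(a, i) \<in> A \<and> (b, i) \<in> A \<and> a < b"
    then have "\<bar>int a - int b\<bar> - 1 \<ge> int s \<and> int (n i) - \<bar>int a - int b\<bar> - 1 \<ge> int s"
      using L unfolding separated_def by blast
    then show "a + s < b \<and> b + s < a + n i" using H by linarith
  qed
next
  assume R: ?R
  show "separated s n A"
    unfolding separated_def
  proof (intro allI impI)
    fix a b i assume H: "(a, i) \<in> A \<and> (b, i) \<in> A \<and> a \<noteq> b"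
    then have "a < b \<longrightarrow> a + s < b \<and> b + s < a + n i" "b < a \<longrightarrow> b + s < a \<and> a + s < b + n i"
      using R by blast+
    then show "\<bar>int a - int b\<bar> - 1 \<ge> int s \<and> int (n i) - \<bar>int a - int b\<bar> - 1 \<ge> int s"
      using H by linarith
  qed
qed

lemma circles_Suc: "circles (Suc p) n = circles p n \<union> {1..n (Suc p)} \<times> {Suc p}"
  by (auto simp: circles_def le_Suc_eq)

lemma card_separated_star_1:
  assumes "1 \<le> s" "1 \<le> n 1"
  shows "card (separated_star (1, 1) s (Suc k) 1 n) = (n 1 - s * Suc k - 1) choose k"
proof -
  let ?f = "\<lambda>C. C \<times> {1 :: nat}"
  have inj: "inj_on ?f X" for X :: "nat set set" by (auto simp: inj_on_def)
  have "separated_star (1, 1) s (Suc k) 1 n = ?f ` {C \<in> circle_sets s (n 1) (Suc k). 1 \<in> C}"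
  proof (intro set_eqI iffI)
    fix A assume A: "A \<in> separated_star (1, 1) s (Suc k) 1 n"
    then have sub: "A \<subseteq> {1..n 1} \<times> {1}"
      by (auto simp: separated_star_def separated_subsets_def circles_def)
    then have eq: "A = ?f (fst ` A)" by force
    have "card A = card (fst ` A)" by (subst eq) (simp add: card_cartesian_product)
    moreover have "(a, 1) \<in> A \<longleftrightarrow> a \<in> fst ` A" for a by (subst eq) auto
    moreover have "fst ` A \<subseteq> {1..n 1}" using sub by auto
    moreover have "a + s < b \<and> b + s < a + n 1" if "(a, 1) \<in> A" "(b, 1) \<in> A" "a < b" for a b
      using A that unfolding separated_star_def separated_subsets_def separated_iff by blast
    moreover have "card A = Suc k" "(1, 1) \<in> A"
      using A by (auto simp: separated_star_def separated_subsets_def)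
    ultimately have "fst ` A \<in> {C \<in> circle_sets s (n 1) (Suc k). 1 \<in> C}"
      unfolding circle_sets_def by simp
    with eq show "A \<in> ?f ` {C \<in> circle_sets s (n 1) (Suc k). 1 \<in> C}" by blast
  next
    fix A assume "A \<in> ?f ` {C \<in> circle_sets s (n 1) (Suc k). 1 \<in> C}"
    then show "A \<in> separated_star (1, 1) s (Suc k) 1 n"
      by (auto simp: separated_star_def separated_subsets_def separated_iff circle_sets_def
          circles_def card_cartesian_product)
  qed
  then show ?thesis
    \<comment> \<open>The fixed point 1 is in the admissible range \<open>{1..s}\<close> because
      \<open>1 \<le> s\<close>.\<close>
    using card_circle_sets_containing [of 1 s "n 1" k] assms
    by (simp only: card_image [OF inj])
qed

text \<open>Different circles do not interact, so a set splits freely into its part on the first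
  \<open>p\<close> circles, which keeps \<open>x\<close>, and its \<open>j\<close> points on the
  last circle.\<close>

lemma separated_star_Suc:
  fixes p :: nat
  assumes "x \<in> circles p n"
  shows "bij_betw (\<lambda>(j, B, C). B \<union> C \<times> {Suc p})
    (SIGMA j:{..k}. separated_star x s (k - j) p n \<times> circle_sets s (n (Suc p)) j)
    (separated_star x s k (Suc p) n)"
proof -
  let ?q = "Suc p"
  let ?S = "SIGMA j:{..k}. separated_star x s (k - j) p n \<times> circle_sets s (n ?q) j"
  let ?part = "\<lambda>A. (card {a. (a, ?q) \<in> A}, A \<inter> circles p n, {a. (a, ?q) \<in> A})"
  have low: "(a, ?q) \<notin> circles p n" for a by (auto simp: circles_def)
  show ?thesis
  proof (rule bij_betw_byWitness [where f' = ?part])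
    show "\<forall>u\<in>?S. ?part ((\<lambda>(j, B, C). B \<union> C \<times> {?q}) u) = u"
    proof (clarsimp)
      fix j B C assume B: "B \<in> separated_star x s (k - j) p n" and C: "C \<in> circle_sets s (n ?q) j"
      have sub: "B \<subseteq> circles p n" using B by (auto simp: separated_star_def separated_subsets_def)
      then have *: "{a. (a, ?q) \<in> B \<or> a \<in> C} = C" using low by auto
      show "card {a. (a, ?q) \<in> B \<or> a \<in> C} = j \<and> (B \<union> C \<times> {?q}) \<inter> circles p n = B
          \<and> {a. (a, ?q) \<in> B \<or> a \<in> C} = C"
        unfolding * using C sub low by (auto simp: circle_sets_def)
    qed
  next
    show "\<forall>A\<in>separated_star x s k ?q n. (\<lambda>(j, B, C). B \<union> C \<times> {?q}) (?part A) = A"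
      by (auto simp: separated_star_def separated_subsets_def circles_Suc)
  next
    show "(\<lambda>(j, B, C). B \<union> C \<times> {?q}) ` ?S \<subseteq> separated_star x s k ?q n"
    proof (clarsimp)
      fix j B C assume j: "j \<le> k" and B: "B \<in> separated_star x s (k - j) p n"
        and C: "C \<in> circle_sets s (n ?q) j"
      have sub: "B \<subseteq> circles p n" and cB: "card B = k - j"
        using B by (auto simp: separated_star_def separated_subsets_def)
      have finB: "finite B" using sub finite_circles finite_subset by blast
      have "B \<inter> C \<times> {?q} = {}" using sub low by auto
      then have "card (B \<union> C \<times> {?q}) = k"
        using finB circle_sets_finite [OF C] cB j C
        by (simp add: card_Un_disjoint card_cartesian_product) (simp add: circle_sets_def)
      moreover have "(a, ?q) \<notin> B" for a using sub low by blast
      ultimately show "B \<union> C \<times> {?q} \<in> separated_star x s k ?q n"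
        using B C sub unfolding separated_star_def separated_subsets_def separated_iff
          circle_sets_def circles_Suc by auto
    qed
  next
    show "?part ` separated_star x s k ?q n \<subseteq> ?S"
    proof (rule image_subsetI)
      fix A assume A: "A \<in> separated_star x s k ?q n"
      define C where "C = {a. (a, ?q) \<in> A}"
      define B where "B = A \<inter> circles p n"
      have sub: "A \<subseteq> circles p n \<union> {1..n ?q} \<times> {?q}" and cA: "card A = k"
        and sep: "separated s n A" and xA: "x \<in> A"
        using A by (auto simp: separated_star_def separated_subsets_def circles_Suc)
      have eq: "A = B \<union> C \<times> {?q}" using sub by (auto simp: B_def C_def)
      have subC: "C \<subseteq> {1..n ?q}" using sub low by (auto simp: C_def)
      then have finC: "finite C" using finite_subset by blast
      have finB: "finite B" by (simp add: B_def finite_circles)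
      have "B \<inter> C \<times> {?q} = {}" using low by (auto simp: B_def)
      then have card: "card B + card C = k"
        using cA finB finC by (subst (asm) eq) (simp add: card_Un_disjoint card_cartesian_product)
      have "B \<in> separated_star x s (k - card C) p n"
        using card sep xA assms
        by (auto simp: separated_star_def separated_subsets_def separated_iff B_def)
      moreover have "C \<in> circle_sets s (n ?q) (card C)"
        using sep subC by (auto simp: circle_sets_def separated_iff C_def)
      ultimately show "?part A \<in> ?S"
        using card unfolding B_def [symmetric] C_def [symmetric] by auto
    qed
  qed
qed

lemma card_separated_star_Suc:
  assumes "x \<in> circles p n"
  shows "card (separated_star x s k (Suc p) n) =
    (\<Sum>j\<le>k. card (separated_star x s (k - j) p n) * card (circle_sets s (n (Suc p)) j))"
  unfolding bij_betw_same_card [OF separated_star_Suc [OF assms], symmetric]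
  by (simp add: card_SigmaI finite_separated_star finite_circle_sets card_cartesian_product)

theorem theorem3:
  fixes s k p :: nat and n :: "nat \<Rightarrow> nat"
  assumes "s \<ge> 1" and "k \<ge> 1" and "p \<ge> 1"
    and "\<And>i. i \<in> {1..p} \<Longrightarrow> n i \<ge> 1"
    and "n 1 \<ge> s * k + 1"
    and "\<And>i. i \<in> {2..p} \<Longrightarrow> n i \<ge> s * k"
  shows "card (separated_star (1, 1) s k p n) = ((\<Sum>i=1..p. n i) - s * k - 1) choose (k - 1)"
  using assms(3,2,5,6)
\<comment> \<open>\<open>k\<close> is generalized, together with the bounds mentioning it, because
  the convolution calls for the smaller sizes \<open>k - j\<close>.\<close>
proof (induction p arbitrary: k rule: dec_induct)
  case base
  then obtain K where "k = Suc K" by (cases k) auto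
  then show ?case using card_separated_star_1 [of s n K] assms(1) base by simp
next
  case (step p)
  obtain K where k: "k = Suc K" using step.prems(1) by (cases k) auto
  define m where "m = n (Suc p)"
  define N where "N = (\<Sum>i=1..p. n i)"
  \<comment> \<open>Chosen to match the Rothe--Hagen form: since \<open>k - j = (K - j) + 1\<close>,
    the upper index \<open>N - s (k - j) - 1\<close> becomes \<open>y - (K - j) s\<close>.\<close>
  define y where "y = real N - 1 - real s"
  have m: "s * k \<le> m" using step.prems(3) [of "Suc p"] step.hyps by (simp add: m_def)
  have "n 1 \<le> N" unfolding N_def using step.hyps by (intro member_le_sum) auto
  then have N: "s * k + 1 \<le> N" using step.prems(2) by simp
  have x: "(1, 1) \<in> circles p n" using step.hyps step.prems by (auto simp: circles_def)
  have star: "real (card (separated_star (1, 1) s (k - j) p n)) =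
      (y - real (K - j) * of_int (int s)) gchoose (K - j)" if "j \<le> K" for j
  proof -
    have kj: "k - j = Suc (K - j)" using that k by simp
    have le: "s * (k - j) \<le> s * k" by simp
    have "card (separated_star (1, 1) s (k - j) p n) = (N - s * (k - j) - 1) choose (k - j - 1)"
      unfolding N_def
    proof (rule step.IH)
      show "k - j \<ge> 1" using kj by simp
      show "n 1 \<ge> s * (k - j) + 1" using le step.prems(2) by linarith
      show "n i \<ge> s * (k - j)" if "i \<in> {2..p}" for i
        using le step.prems(3) [of i] that by (meson atLeastAtMost_iff le_SucI le_trans)
    qed
    moreover have "real (N - s * (k - j) - 1) = y - real (K - j) * of_int (int s)"
    proof -
      have "s * (k - j) + 1 \<le> N" using le N by linarith
      then have "real (N - s * (k - j) - 1) = real N - real s * real (k - j) - 1"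
        by (simp add: of_nat_diff)
      then show ?thesis unfolding kj by (simp add: y_def algebra_simps)
    qed
    ultimately show ?thesis by (simp add: binomial_gbinomial kj)
  qed
  have circ: "real (card (circle_sets s m j)) = rothe (int s) j (int m)" if "j \<le> K" for j
  proof (rule real_card_circle_sets)
    \<comment> \<open>As \<open>j \<le> K = k - 1\<close>, the assumed size \<open>s * k\<close> of
      the new circle is large enough for every term.\<close>
    have "s * Suc j \<le> s * k" using that k by (intro mult_le_mono2) simp
    then show "s * Suc j \<le> m" using m by simp
  qed (rule assms(1))
  \<comment> \<open>The sum stops at \<open>K\<close>: the term \<open>j = k\<close> vanishes, since
    the fixed point needs a place.\<close>
  have "card (separated_star (1, 1) s k (Suc p) n) =
      (\<Sum>j\<le>K. card (separated_star (1, 1) s (k - j) p n) * card (circle_sets s m j))"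
    unfolding card_separated_star_Suc [OF x] m_def by (simp add: k separated_star_0)
  then have "real (card (separated_star (1, 1) s k (Suc p) n)) =
      (\<Sum>j\<le>K. rothe (int s) j (int m) * ((y - real (K - j) * of_int (int s)) gchoose (K - j)))"
    by (simp only: of_nat_sum of_nat_mult)
      (intro sum.cong refl, simp only: atMost_iff star circ mult.commute)
  also have "\<dots> = (of_int (int m) + y - real K * of_int (int s)) gchoose K"
    by (rule rothe_hagen)
  also have "of_int (int m) + y - real K * of_int (int s) = real (N + m - s * k - 1)"
    using N by (simp add: y_def k of_nat_diff algebra_simps)
  also have "\<dots> gchoose K = real ((N + m - s * k - 1) choose K)"
    by (simp only: binomial_gbinomial)
  finally show ?case
    using step.hyps by (simp add: N_def m_def k)
qed

end
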